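(* Let $a,b\in\mathbb{C}$ with $|a|^2+|b|^2=1$, and consider a star-linear network using a total of $x$ pairs in the state $|\eta\rangle=a|00\rangle+b|11\rangle$, where $j\ge2$ of the pairs form the star and the remaining $x-j\ge 0$ pairs are used in successive linear swaps. If $x$ is even, the probability $P_{max}$ of obtaining the maximally entangled (GHZ) state $|\xi_0\rangle$ as the final output after all the entanglement swaps is $$P_{max}=\binom{x}{\frac{x}{2}}|a|^x|b|^x .$$
   Context: For $m\in\{0,1,2,\dots\}$ put $n_m=\sqrt{|a|^{2m}+|b|^{2m}}$ (with $0^0=1$), $|\eta_m\rangle=\frac{a^m|00\rangle+b^m|11\rangle}{n_m}$ and, on $j$ qubits, $|\xi_m\rangle=\frac{a^m|0\rangle^{\otimes j}+b^m|1\rangle^{\otimes j}}{n_m}$. States are identified when they agree up to a global phase and up to the simultaneous bit flip $X^{\otimes j}$. Measurement outcomes are not recorded, so outputs are random pure states; labels are formal, i.e. the probability of $|\xi_k\rangle$ is the total probability of the outcomes giving index $k$, as specified below. $P_{max}$ is the probability that the final index is $0$. The protocol: first a star swap on $|\eta\rangle^{\otimes j}$: pair $i$ ($1\le i\le j$) consists of a peripheral qubit $q_i$ and a central qubit $c_i$; apply CNOT gates with control $c_1$ and target $c_i$ for every $i\ge2$; apply a Hadamard gate to $c_1$; measure all $c_i$ in the computational basis with outcomes $t_i$; apply $Z^{t_1}$ to $q_1$ and $X^{t_i}$ to $q_i$ for $i\ge2$; the output is the $j$-qubit state of the $q_i$. Outcomes with $o=t_2+\dots+t_j$ give index $|j-2o|$.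 Then $x-j$ successive linear swaps, each of the current $j$-qubit state $|\xi_m\rangle$ with a fresh copy of $|\eta\rangle$, with independent measurement randomness: choose one of the $j$ qubits, call it $r$, and another one, $r'$; let the fresh pair consist of qubits $u,v$; apply CNOT with control $r$ and target $u$; apply a Hadamard gate to $r$; measure $r,u$ in the computational basis with outcomes $s,t$; apply $Z^s$ to $r'$ and $X^t$ to $v$; the new $j$-qubit state has $v$ in place of $r$. Outcome $t=0$ gives index $m+1$, and $t=1$ gives index $|m-1|$. *)

theory Defs
  imports Complex_Main
begin

section \<open>Pure states on labelled qubits\<close>

text \<open>
  A computational basis vector of a register \<open>S\<close> of labelled qubits is a bit assignment that is
  \<open>False\<close> outside \<open>S\<close>; a state vector is given by its amplitudes, and only the amplitudes at
  elements of \<open>basis S\<close> matter.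
\<close>

type_synonym 'q bits = "'q \<Rightarrow> bool"
type_synonym 'q state = "'q bits \<Rightarrow> complex"

definition basis :: "'q set \<Rightarrow> 'q bits set" where
  "basis S = {w. \<forall>q. q \<notin> S \<longrightarrow> \<not> w q}"

definition restrict_bits :: "'q set \<Rightarrow> 'q bits \<Rightarrow> 'q bits" where
  "restrict_bits S w = (\<lambda>q. q \<in> S \<and> w q)"

definition ones :: "'q set \<Rightarrow> 'q bits" where
  "ones S = (\<lambda>q. q \<in> S)"

definition ket :: "'q bits \<Rightarrow> 'q state" where
  "ket v = (\<lambda>w. if w = v then 1 else 0)"

definition sq_norm :: "'q set \<Rightarrow> 'q state \<Rightarrow> real" where
  "sq_norm S \<psi> = (\<Sum>w\<in>basis S. (cmod (\<psi> w))\<^sup>2)"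

definition tensor :: "'q set \<Rightarrow> 'q set \<Rightarrow> 'q state \<Rightarrow> 'q state \<Rightarrow> 'q state" where
  "tensor S T \<psi> \<phi> = (\<lambda>w. \<psi> (restrict_bits S w) * \<phi> (restrict_bits T w))"

definition gate_X :: "'q \<Rightarrow> 'q state \<Rightarrow> 'q state" where
  "gate_X q \<psi> = (\<lambda>w. \<psi> (w(q := \<not> w q)))"

definition gate_Z :: "'q \<Rightarrow> 'q state \<Rightarrow> 'q state" where
  "gate_Z q \<psi> = (\<lambda>w. if w q then - \<psi> w else \<psi> w)"

definition gate_H :: "'q \<Rightarrow> 'q state \<Rightarrow> 'q state" where
  "gate_H q \<psi> = (\<lambda>w. (\<psi> (w(q := False)) + (if w q then -1 else 1) * \<psi> (w(q := True)))
                     / complex_of_real (sqrt 2))"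

definition gate_CNOT :: "'q \<Rightarrow> 'q \<Rightarrow> 'q state \<Rightarrow> 'q state" where
  "gate_CNOT c t \<psi> = (\<lambda>w. \<psi> (w(t := (w t \<noteq> w c))))"

text \<open>
  \<open>measured M t \<psi>\<close> is the unnormalised state of the remaining qubits after the qubits in \<open>M\<close> have
  been measured with outcome \<open>t\<close> (the partial inner product with the basis vector \<open>t\<close> of \<open>M\<close>); by
  the Born rule its squared norm is the probability of \<open>t\<close>.
\<close>

definition measured :: "'q set \<Rightarrow> 'q bits \<Rightarrow> 'q state \<Rightarrow> 'q state" where
  "measured M t \<psi> = (\<lambda>w. \<psi> (\<lambda>q. if q \<in> M then t q else w q))"


section \<open>The states of the protocol\<close>

datatype qubit = Peripheral nat | Central nat | FreshU | FreshV

definition reg :: "nat \<Rightarrow> qubit set" where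
  "reg j = Peripheral ` {1..j}"

definition eta :: "complex \<Rightarrow> complex \<Rightarrow> qubit \<Rightarrow> qubit \<Rightarrow> qubit state" where
  "eta a b p q = (\<lambda>w. a * ket (ones {}) w + b * ket (ones {p, q}) w)"

definition nrm :: "complex \<Rightarrow> complex \<Rightarrow> nat \<Rightarrow> real" where
  "nrm a b m = sqrt (cmod a ^ (2 * m) + cmod b ^ (2 * m))"

definition xi :: "complex \<Rightarrow> complex \<Rightarrow> nat \<Rightarrow> nat \<Rightarrow> qubit state" where
  "xi a b j m = (\<lambda>w. (a ^ m * ket (ones {}) w + b ^ m * ket (ones (reg j)) w)
                     / complex_of_real (nrm a b m))"

definition flip_all :: "nat \<Rightarrow> qubit state \<Rightarrow> qubit state" where
  "flip_all j \<psi> = (\<lambda>w. \<psi> (\<lambda>q. if q \<in> reg j then \<not> w q else w q))"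

text \<open>
  The identification of \<open>j\<close>-qubit states, on nonzero unnormalised vectors: the scalar \<open>c\<close> absorbs
  the global phase and the normalisation.
\<close>

definition same_state :: "nat \<Rightarrow> qubit state \<Rightarrow> qubit state \<Rightarrow> bool" where
  "same_state j \<phi> \<psi> \<longleftrightarrow> (\<exists>c. c \<noteq> 0 \<and>
     ((\<forall>w\<in>basis (reg j). \<phi> w = c * \<psi> w) \<or> (\<forall>w\<in>basis (reg j). \<phi> w = c * flip_all j \<psi> w)))"


section \<open>Star swap\<close>

definition star_input :: "complex \<Rightarrow> complex \<Rightarrow> nat \<Rightarrow> qubit state" where
  "star_input a b j = (\<lambda>w. \<Prod>i\<in>{1..j}. eta a b (Peripheral i) (Central i)
                               (restrict_bits {Peripheral i, Central i} w))"

definition star_premeasure :: "complex \<Rightarrow> complex \<Rightarrow> nat \<Rightarrow> qubit state" where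
  "star_premeasure a b j =
     gate_H (Central 1) (fold (\<lambda>i. gate_CNOT (Central 1) (Central i)) [2..<Suc j] (star_input a b j))"

text \<open>The outcome \<open>t\<close> ranges over \<open>basis (Central ` {1..j})\<close>.\<close>

definition star_output :: "complex \<Rightarrow> complex \<Rightarrow> nat \<Rightarrow> qubit bits \<Rightarrow> qubit state" where
  "star_output a b j t =
     fold (\<lambda>i. if t (Central i) then gate_X (Peripheral i) else id) [2..<Suc j]
       ((if t (Central 1) then gate_Z (Peripheral 1) else id)
         (measured (Central ` {1..j}) t (star_premeasure a b j)))"

definition star_prob :: "complex \<Rightarrow> complex \<Rightarrow> nat \<Rightarrow> qubit bits \<Rightarrow> real" where
  "star_prob a b j t = sq_norm (reg j) (star_output a b j t)"

definition star_index :: "nat \<Rightarrow> qubit bits \<Rightarrow> nat" where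
  "star_index j t = nat \<bar>int j - 2 * int (card {i\<in>{2..j}. t (Central i)})\<bar>"


section \<open>Linear swap\<close>

definition linear_premeasure ::
    "complex \<Rightarrow> complex \<Rightarrow> nat \<Rightarrow> nat \<Rightarrow> nat \<Rightarrow> qubit state" where
  "linear_premeasure a b j m r =
     gate_H (Peripheral r) (gate_CNOT (Peripheral r) FreshU
       (tensor (reg j) {FreshU, FreshV} (xi a b j m) (eta a b FreshU FreshV)))"

text \<open>
  In the new state the qubit \<open>v\<close> takes the place, and here also the label, of the measured
  qubit \<open>r\<close>.
\<close>

definition linear_output ::
    "complex \<Rightarrow> complex \<Rightarrow> nat \<Rightarrow> nat \<Rightarrow> nat \<times> nat \<Rightarrow> bool \<times> bool \<Rightarrow> qubit state" where
  "linear_output a b j m = (\<lambda>(r, r') (s, t).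
     let \<phi> = (if t then gate_X FreshV else id)
               ((if s then gate_Z (Peripheral r') else id)
                 (measured {Peripheral r, FreshU} ((\<lambda>_. False)(Peripheral r := s, FreshU := t))
                   (linear_premeasure a b j m r)))
     in (\<lambda>w. \<phi> (w(FreshV := w (Peripheral r), Peripheral r := False))))"

definition linear_prob ::
    "complex \<Rightarrow> complex \<Rightarrow> nat \<Rightarrow> nat \<Rightarrow> nat \<times> nat \<Rightarrow> bool \<times> bool \<Rightarrow> real" where
  "linear_prob a b j m rr st = sq_norm (reg j) (linear_output a b j m rr st)"

definition linear_index :: "nat \<Rightarrow> bool \<times> bool \<Rightarrow> nat" where
  "linear_index m = (\<lambda>(s, t). if t then nat \<bar>int m - 1\<bar> else m + 1)"


section \<open>The star-linear network\<close>

text \<open>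
  \<open>rs\<close> lists the pairs \<open>(r, r')\<close> chosen in the successive linear swaps, \<open>os\<close> the outcomes
  \<open>(s, t)\<close>, and \<open>m\<close> is the current index.
\<close>

fun chain_index :: "nat \<Rightarrow> (bool \<times> bool) list \<Rightarrow> nat" where
  "chain_index m [] = m"
| "chain_index m (st # os) = chain_index (linear_index m st) os"

fun chain_prob ::
    "complex \<Rightarrow> complex \<Rightarrow> nat \<Rightarrow> nat \<Rightarrow> (nat \<times> nat) list \<Rightarrow> (bool \<times> bool) list \<Rightarrow> real" where
  "chain_prob a b j m (rr # rs) (st # os) =
     linear_prob a b j m rr st * chain_prob a b j (linear_index m st) rs os"
| "chain_prob a b j m _ _ = 1"

definition final_prob :: "complex \<Rightarrow> complex \<Rightarrow> nat \<Rightarrow> (nat \<times> nat) list \<Rightarrow> nat \<Rightarrow> real" where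
  "final_prob a b j rs k =
     (\<Sum>(t, os) \<in> {(t, os). t \<in> basis (Central ` {1..j}) \<and> length os = length rs
                          \<and> chain_index (star_index j t) os = k}.
        star_prob a b j t * chain_prob a b j (star_index j t) rs os)"

definition P_max :: "complex \<Rightarrow> complex \<Rightarrow> nat \<Rightarrow> (nat \<times> nat) list \<Rightarrow> real" where
  "P_max a b j rs = final_prob a b j rs 0"


section \<open>The index labels are consistent with the states\<close>

text \<open>
  Each linear swap is defined on the representative \<open>xi a b j m\<close> of the current state. This is
  justified by \<open>star_output_same_state\<close> and \<open>linear_output_same_state\<close> below: an outcome of nonzero
  probability whose index is \<open>k\<close> leaves a state that is identified with \<open>xi a b j k\<close>.
\<close>

lemma reg_iff: "Peripheral i \<in> reg j \<longleftrightarrow> 1 \<le> i \<and> i \<le> j" "FreshU \<notin> reg j" "FreshV \<notin> reg j" "Central i \<notin> reg j"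
  by (auto simp: reg_def)

lemma nrm_pos: assumes "a \<noteq> 0 \<or> b \<noteq> 0" shows "nrm a b m > 0"
proof -
  have "cmod a ^ (2*m) + cmod b ^ (2*m) > 0"
    using assms by (auto intro: add_pos_nonneg add_nonneg_pos)
  then show ?thesis by (simp add: nrm_def)
qed

definition ghz_vec :: "complex \<Rightarrow> complex \<Rightarrow> nat \<Rightarrow> qubit state" where
  "ghz_vec p q j = (\<lambda>w. p * ket (ones {}) w + q * ket (ones (reg j)) w)"

lemma basis_reg_ket:
  assumes "w \<in> basis (reg j)"
  shows "ket (ones {}) w = (if \<forall>i\<in>{1..j}. \<not> w (Peripheral i) then 1 else 0)"
    "ket (ones (reg j)) w = (if \<forall>i\<in>{1..j}. w (Peripheral i) then 1 else 0)"
proof -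
  have o: "\<not> w q" if "q \<notin> reg j" for q using assms that by (auto simp: basis_def)
  show "ket (ones {}) w = (if \<forall>i\<in>{1..j}. \<not> w (Peripheral i) then 1 else 0)"
  proof -
    have "(w = ones {}) = (\<forall>i\<in>{1..j}. \<not> w (Peripheral i))"
    proof
      assume "\<forall>i\<in>{1..j}. \<not> w (Peripheral i)"
      then have "\<not> w q" for q using o by (cases "q \<in> reg j") (auto simp: reg_def)
      then show "w = ones {}" by (simp add: ones_def fun_eq_iff)
    qed (simp add: ones_def)
    then show ?thesis by (simp add: ket_def)
  qed
  show "ket (ones (reg j)) w = (if \<forall>i\<in>{1..j}. w (Peripheral i) then 1 else 0)"
  proof -
    have "(w = ones (reg j)) = (\<forall>i\<in>{1..j}. w (Peripheral i))"
      using o by (auto simp: ones_def fun_eq_iff reg_def)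
    then show ?thesis by (simp add: ket_def)
  qed
qed

lemma eta_eval:
  assumes "p \<noteq> q"
  shows "eta a b p q (restrict_bits {p,q} w) = (if w p = w q then if w p then b else a else 0)"
proof -
  have "(restrict_bits {p,q} w = ones {}) = (\<not> w p \<and> \<not> w q)"
    using assms by (fastforce simp: restrict_bits_def ones_def fun_eq_iff)
  moreover have "(restrict_bits {p,q} w = ones {p,q}) = (w p \<and> w q)"
    using assms by (fastforce simp: restrict_bits_def ones_def fun_eq_iff)
  ultimately show ?thesis by (auto simp: eta_def ket_def)
qed

lemma same_state_ghz:
  assumes ab: "a \<noteq> 0 \<or> b \<noteq> 0" and d: "d \<noteq> 0"
    and pq: "(p = d * a ^ m \<and> q = d * b ^ m) \<or> (p = d * b ^ m \<and> q = d * a ^ m)"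
    and \<phi>: "\<forall>w\<in>basis (reg j). \<phi> w = ghz_vec p q j w" and j: "j \<ge> 1"
  shows "same_state j \<phi> (xi a b j m)"
proof -
  let ?c = "d * complex_of_real (nrm a b m)"
  have n: "complex_of_real (nrm a b m) \<noteq> 0" using nrm_pos[OF ab, of m] by simp
  have f: "flip_all j (xi a b j m) w = ghz_vec (b^m) (a^m) j w / complex_of_real (nrm a b m)"
    if w: "w \<in> basis (reg j)" for w
  proof -
    let ?w = "\<lambda>q. if q \<in> reg j then \<not> w q else w q"
    have w': "?w \<in> basis (reg j)" using w by (auto simp: basis_def)
    show ?thesis using j unfolding flip_all_def xi_def ghz_vec_def basis_reg_ket[OF w] basis_reg_ket[OF w']
      by (auto simp: reg_iff)
  qed
  from pq show ?thesis
  proof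
    assume "p = d * a ^ m \<and> q = d * b ^ m"
    then have "\<forall>w\<in>basis (reg j). \<phi> w = ?c * xi a b j m w"
      using \<phi> n by (auto simp: ghz_vec_def xi_def field_simps)
    then show ?thesis unfolding same_state_def using d n by (intro exI[of _ ?c]) auto
  next
    assume "p = d * b ^ m \<and> q = d * a ^ m"
    then have "\<forall>w\<in>basis (reg j). \<phi> w = ?c * flip_all j (xi a b j m) w"
      using \<phi> n f by (auto simp: ghz_vec_def field_simps)
    then show ?thesis unfolding same_state_def using d n by (intro exI[of _ ?c]) auto
  qed
qed

lemma linear_output_aux:
  fixes a b p q N S :: complex
  assumes "z \<Longrightarrow> \<not> w'" "z' \<Longrightarrow> w'"
  shows "(if s \<and> w' then -1 else 1) *
      (((if t = (u \<noteq> t) then if t then b else a else 0) * (if z then p / N else 0)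
        + (if s then -1 else 1) * (if (\<not> t) = (u \<noteq> t) then if u \<noteq> t then b else a else 0)
          * (if z' then q / N else 0)) / S)
    = p * (if t then b else a) / (N * S) * (if \<not> u \<and> z then 1 else 0)
      + q * (if t then a else b) / (N * S) * (if u \<and> z' then 1 else 0)"
  using assms by (cases z; cases z'; cases s; cases t; cases u) simp_all

lemma linear_output_ghz:
  assumes r: "r \<in> {1..j}" "r' \<in> {1..j}" "r \<noteq> r'" and w: "w \<in> basis (reg j)"
  shows "linear_output a b j m (r, r') (s, t) w =
    ghz_vec (a^m * (if t then b else a) / (nrm a b m * sqrt 2)) (b^m * (if t then a else b) / (nrm a b m * sqrt 2)) j w"
proof -
  have X: "xi a b j m (restrict_bits (reg j) w') = 
    (a ^ m * (if \<forall>i\<in>{1..j}. \<not> w' (Peripheral i) then 1 else 0) + b ^ m * (if \<forall>i\<in>{1..j}. w' (Peripheral i) then 1 else 0)) / complex_of_real (nrm a b m)" for w'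
  proof -
    have *: "restrict_bits (reg j) w' \<in> basis (reg j)" by (auto simp: basis_def restrict_bits_def)
    show ?thesis unfolding xi_def basis_reg_ket[OF *] by (auto simp: restrict_bits_def reg_iff)
  qed
  have E: "eta a b FreshU FreshV (restrict_bits {FreshU, FreshV} w') = (if w' FreshU = w' FreshV then if w' FreshU then b else a else 0)" for w'
    by (rule eta_eval) simp
  have r0: "r \<in> {1..j}" "Suc 0 \<le> r" "r \<le> j" "Suc 0 \<le> r'" "r' \<le> j" using r by auto
  have A: "(\<forall>i\<in>{1..j}. if i = r then P else Q i) = (P \<and> (\<forall>i\<in>{1..j}. i \<noteq> r \<longrightarrow> Q i))" for P Q
    using r0 by auto
  let ?z = "\<forall>i\<in>{1..j}. i \<noteq> r \<longrightarrow> \<not> w (Peripheral i)" and ?o = "\<forall>i\<in>{1..j}. i \<noteq> r \<longrightarrow> w (Peripheral i)"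
  have zr: "?z \<Longrightarrow> \<not> w (Peripheral r')" "?o \<Longrightarrow> w (Peripheral r')" using r by auto
  then have zo: "\<not> (?z \<and> ?o)" by blast
  have Z: "(\<forall>i\<in>{1..j}. \<not> w (Peripheral i)) = (\<not> w (Peripheral r) \<and> ?z)" using r0 by auto
  have O: "(\<forall>i\<in>{1..j}. w (Peripheral i)) = (w (Peripheral r) \<and> ?o)" using r0 by auto
  define I where "I = tensor (reg j) {FreshU, FreshV} (xi a b j m) (eta a b FreshU FreshV)"
  have I: "I w' = (if w' FreshU = w' FreshV then if w' FreshU then b else a else 0) *
     ((a ^ m * (if \<forall>i\<in>{1..j}. \<not> w' (Peripheral i) then 1 else 0) + b ^ m * (if \<forall>i\<in>{1..j}. w' (Peripheral i) then 1 else 0)) / complex_of_real (nrm a b m))" for w'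
    by (simp add: I_def tensor_def X E)
  have A1: "(\<forall>i\<in>{1..j}. \<not> (if i = r then P else w (Peripheral i))) = (\<not> P \<and> ?z)" 
     "(\<forall>i\<in>{1..j}. (if i = r then P else w (Peripheral i))) = (P \<and> ?o)" for P
    using r0 by auto
  have M: "measured {Peripheral r, FreshU} ((\<lambda>_. False)(Peripheral r := s, FreshU := t)) (linear_premeasure a b j m r) (w(FreshV := v, Peripheral r := False))
    = ((if t = v then if t then b else a else 0) * (if ?z then a ^ m / nrm a b m else 0)
       + (if s then -1 else 1) * (if (\<not>t) = v then if v then b else a else 0) * (if ?o then b ^ m / nrm a b m else 0)) / sqrt 2" for v
  proof -
    let ?w1 = "w(FreshV := v, Peripheral r := False, FreshU := t)"
    let ?w2 = "w(FreshV := v, Peripheral r := True, FreshU := \<not> t)"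
    have "I ?w1 = (if t = v then if t then b else a else 0) * (if ?z then a ^ m / nrm a b m else 0)"
      unfolding I using r0 zo by (auto simp: A1)
    moreover have "I ?w2 = (if (\<not>t) = v then if v then b else a else 0) * (if ?o then b ^ m / nrm a b m else 0)"
      unfolding I using r0 zo by (auto simp: A1)
    moreover have "measured {Peripheral r, FreshU} ((\<lambda>_. False)(Peripheral r := s, FreshU := t)) (linear_premeasure a b j m r) (w(FreshV := v, Peripheral r := False))
      = (I ?w1 + (if s then -1 else 1) * I ?w2) / sqrt 2"
    proof -
      let ?x = "\<lambda>q. if q \<in> {Peripheral r, FreshU} then ((\<lambda>_. False)(Peripheral r := s, FreshU := t)) q else (w(FreshV := v, Peripheral r := False)) q"
      have "(?x(Peripheral r := False))(FreshU := (?x(Peripheral r := False)) FreshU \<noteq> (?x(Peripheral r := False)) (Peripheral r)) = ?w1"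
        "(?x(Peripheral r := True))(FreshU := (?x(Peripheral r := True)) FreshU \<noteq> (?x(Peripheral r := True)) (Peripheral r)) = ?w2"
        by (rule ext; auto)+
      then show ?thesis
        unfolding measured_def linear_premeasure_def I_def[symmetric] gate_H_def gate_CNOT_def by simp
    qed
    ultimately show ?thesis by simp
  qed
  have "linear_output a b j m (r, r') (s, t) w = 
     (if s \<and> w (Peripheral r') then -1 else 1) * 
     measured {Peripheral r, FreshU} ((\<lambda>_. False)(Peripheral r := s, FreshU := t)) (linear_premeasure a b j m r) (w(FreshV := (w (Peripheral r) \<noteq> t), Peripheral r := False))"
    using r(3) by (auto simp: linear_output_def Let_def gate_X_def gate_Z_def fun_upd_twist)
  also have "\<dots> = ghz_vec (a^m * (if t then b else a) / (nrm a b m * sqrt 2)) (b^m * (if t then a else b) / (nrm a b m * sqrt 2)) j w"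
    unfolding M ghz_vec_def basis_reg_ket[OF w] Z O of_real_mult
    by (rule linear_output_aux[OF zr])
  finally show ?thesis .
qed

lemma fold_CNOT:
  "n \<ge> 1 \<Longrightarrow> fold (\<lambda>i. gate_CNOT (Central 1) (Central i)) [2..<Suc n] \<psi> w =
    \<psi> (\<lambda>q. case q of Central i \<Rightarrow> if 2 \<le> i \<and> i \<le> n then w q \<noteq> w (Central 1) else w q | _ \<Rightarrow> w q)"
proof (induction n arbitrary: w rule: nat_induct_at_least)
  case base
  have "(\<lambda>q. case q of Central i \<Rightarrow> if 2 \<le> i \<and> i \<le> 1 then w q \<noteq> w (Central 1) else w q | _ \<Rightarrow> w q) = w"
    by (intro ext, rename_tac q, case_tac q) auto
  then show ?case by simp
next
  case (Suc n)
  have "[2..<Suc (Suc n)] = [2..<Suc n] @ [Suc n]" using Suc by simp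
  then have "fold (\<lambda>i. gate_CNOT (Central 1) (Central i)) [2..<Suc (Suc n)] \<psi> w
    = fold (\<lambda>i. gate_CNOT (Central 1) (Central i)) [2..<Suc n] \<psi> (w(Central (Suc n) := (w (Central (Suc n)) \<noteq> w (Central 1))))"
    by (simp add: gate_CNOT_def)
  also have "\<dots> = \<psi> (\<lambda>q. case q of Central i \<Rightarrow> if 2 \<le> i \<and> i \<le> Suc n then w q \<noteq> w (Central 1) else w q | _ \<Rightarrow> w q)"
    unfolding Suc.IH using Suc.hyps by (intro arg_cong[where f=\<psi>] ext, rename_tac q, case_tac q) (simp_all add: le_Suc_eq, linarith?)
  finally show ?case .
qed

lemma fold_X:
  "n \<ge> 1 \<Longrightarrow> fold (\<lambda>i. if t (Central i) then gate_X (Peripheral i) else id) [2..<Suc n] \<psi> w =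
    \<psi> (\<lambda>q. case q of Peripheral i \<Rightarrow> if 2 \<le> i \<and> i \<le> n then w q \<noteq> t (Central i) else w q | _ \<Rightarrow> w q)"
proof (induction n arbitrary: w rule: nat_induct_at_least)
  case base
  have "(\<lambda>q. case q of Peripheral i \<Rightarrow> if 2 \<le> i \<and> i \<le> 1 then w q \<noteq> t (Central i) else w q | _ \<Rightarrow> w q) = w"
    by (intro ext, rename_tac q, case_tac q) auto
  then show ?case by simp
next
  case (Suc n)
  have "[2..<Suc (Suc n)] = [2..<Suc n] @ [Suc n]" using Suc by simp
  then have "fold (\<lambda>i. if t (Central i) then gate_X (Peripheral i) else id) [2..<Suc (Suc n)] \<psi> w
    = fold (\<lambda>i. if t (Central i) then gate_X (Peripheral i) else id) [2..<Suc n] \<psi> (w(Peripheral (Suc n) := (w (Peripheral (Suc n)) \<noteq> t (Central (Suc n)))))"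
    by (simp add: gate_X_def)
  also have "\<dots> = \<psi> (\<lambda>q. case q of Peripheral i \<Rightarrow> if 2 \<le> i \<and> i \<le> Suc n then w q \<noteq> t (Central i) else w q | _ \<Rightarrow> w q)"
    unfolding Suc.IH using Suc.hyps by (intro arg_cong[where f=\<psi>] ext, rename_tac q, case_tac q) (simp_all add: le_Suc_eq, linarith?)
  finally show ?case .
qed

lemma prod_if_zero:
  assumes "finite A"
  shows "(\<Prod>i\<in>A. if P i then f i else (0::complex)) = (if \<forall>i\<in>A. P i then \<Prod>i\<in>A. f i else 0)"
  using assms by (auto intro: prod.cong)

lemma star_input_eval:
  "star_input a b j w = (if \<forall>i\<in>{1..j}. w (Peripheral i) = w (Central i) then \<Prod>i\<in>{1..j}. if w (Peripheral i) then b else a else 0)"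
proof -
  have "star_input a b j w = (\<Prod>i\<in>{1..j}. if w (Peripheral i) = w (Central i) then if w (Peripheral i) then b else a else 0)"
    unfolding star_input_def by (intro prod.cong refl eta_eval) simp
  then show ?thesis by (subst (asm) prod_if_zero) auto
qed

lemma prod_two_values:
  assumes "2 \<le> j"
  shows "(\<Prod>i\<in>{1..j}. if i = 1 then c else if T i then c' else c) = (c::complex) ^ (j - card {i\<in>{2..j}. T i}) * c' ^ card {i\<in>{2..j}. T i}"
proof -
  let ?A = "{i\<in>{2..j}. T i}"
  have sub: "?A \<subseteq> {1..j}" by auto
  have "(\<Prod>i\<in>{1..j}. if i = 1 then c else if T i then c' else c) = (\<Prod>i\<in>{1..j}. if i \<in> ?A then c' else c)"
    by (intro prod.cong) auto
  also have "\<dots> = c' ^ card ?A * c ^ card ({1..j} - ?A)"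
    using sub by (simp add: prod.If_cases Int_absorb1 Diff_eq del: mem_Collect_eq)
  also have "card ({1..j} - ?A) = j - card ?A" using sub by (simp add: card_Diff_subset)
  finally show ?thesis by simp
qed

lemma star_output_ghz:
  fixes t :: "qubit bits"
  assumes j: "2 \<le> j" and w: "w \<in> basis (reg j)"
  defines "k \<equiv> card {i\<in>{2..j}. t (Central i)}"
  shows "star_output a b j t w = ghz_vec (a ^ (j - k) * b ^ k / sqrt 2) (b ^ (j - k) * a ^ k / sqrt 2) j w"
proof -
  let ?v = "\<lambda>q. case q of Peripheral i \<Rightarrow> if 2 \<le> i \<and> i \<le> j then w q \<noteq> t (Central i) else w q | _ \<Rightarrow> w q"
  let ?u = "\<lambda>q. if q \<in> Central ` {1..j} then t q else ?v q"
  let ?s = "\<lambda>c q. case q of Central i \<Rightarrow> if 2 \<le> i \<and> i \<le> j then t q \<noteq> c else if i = 1 then c else w q | _ \<Rightarrow> ?v q"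
  let ?Z = "\<forall>i\<in>{1..j}. \<not> w (Peripheral i)" and ?O = "\<forall>i\<in>{1..j}. w (Peripheral i)"
  have j1: "1 \<le> j" "Suc 0 \<le> j" using j by auto
  have "star_output a b j t w = (if t (Central 1) \<and> w (Peripheral 1) then -1 else 1) * star_premeasure a b j ?u"
    unfolding star_output_def fold_X[OF j1(1)] by (auto simp: gate_Z_def measured_def)
  also have "star_premeasure a b j ?u = (star_input a b j (?s False) + (if t (Central 1) then -1 else 1) * star_input a b j (?s True)) / sqrt 2"
  proof -
    have "(\<lambda>q. case q of Central i \<Rightarrow> if 2 \<le> i \<and> i \<le> j then (?u(Central 1 := c)) q \<noteq> (?u(Central 1 := c)) (Central 1) else (?u(Central 1 := c)) q | _ \<Rightarrow> (?u(Central 1 := c)) q) = ?s c" for c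
      by (intro ext, rename_tac q, case_tac q) auto
    moreover have "?u (Central 1) = t (Central 1)" using j1 by auto
    ultimately show ?thesis unfolding star_premeasure_def gate_H_def fold_CNOT[OF j1(1)] by simp
  qed
  also have "star_input a b j (?s False) = (if ?Z then a ^ (j - k) * b ^ k else 0)"
  proof -
    have "(\<forall>i\<in>{1..j}. ?s False (Peripheral i) = ?s False (Central i)) = ?Z"
      by (intro ball_cong refl) (auto simp: not_le less_Suc_eq)
    moreover have "(\<Prod>i\<in>{1..j}. if ?s False (Peripheral i) then b else a) = a ^ (j - k) * b ^ k" if ?Z
      unfolding k_def prod_two_values[OF j, symmetric] using that by (intro prod.cong) auto
    ultimately show ?thesis unfolding star_input_eval by auto
  qed
  also have "star_input a b j (?s True) = (if ?O then b ^ (j - k) * a ^ k else 0)"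
  proof -
    have "(\<forall>i\<in>{1..j}. ?s True (Peripheral i) = ?s True (Central i)) = ?O"
      by (intro ball_cong refl) (auto simp: not_le less_Suc_eq)
    moreover have "(\<Prod>i\<in>{1..j}. if ?s True (Peripheral i) then b else a) = b ^ (j - k) * a ^ k" if ?O
      unfolding k_def prod_two_values[OF j, symmetric] using that by (intro prod.cong) auto
    ultimately show ?thesis unfolding star_input_eval by auto
  qed
  also have "(if t (Central 1) \<and> w (Peripheral 1) then -1 else 1) * (((if ?Z then a ^ (j - k) * b ^ k else 0) + (if t (Central 1) then -1 else 1) * (if ?O then b ^ (j - k) * a ^ k else 0)) / complex_of_real (sqrt 2))
    = ghz_vec (a ^ (j - k) * b ^ k / sqrt 2) (b ^ (j - k) * a ^ k / sqrt 2) j w"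
    using j1 unfolding ghz_vec_def basis_reg_ket[OF w] by auto
  finally show ?thesis .
qed

lemma sq_norm_nonzeroD:
  assumes "sq_norm (reg j) \<phi> \<noteq> 0" "\<forall>w\<in>basis (reg j). \<phi> w = ghz_vec p q j w" 
  shows "p \<noteq> 0 \<or> q \<noteq> 0"
  using assms by (auto simp: sq_norm_def ghz_vec_def)

theorem star_output_same_state:
  assumes ab: "a \<noteq> 0 \<or> b \<noteq> 0" and j: "2 \<le> j" and pos: "star_prob a b j t \<noteq> 0"
  shows "same_state j (star_output a b j t) (xi a b j (star_index j t))"
proof -
  define k where "k = card {i\<in>{2..j}. t (Central i)}"
  let ?p = "a ^ (j - k) * b ^ k / complex_of_real (sqrt 2)" and ?q = "b ^ (j - k) * a ^ k / complex_of_real (sqrt 2)"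
  have "k \<le> card {2..j}" unfolding k_def by (rule card_mono) auto
  then have kj: "k < j" using j by simp
  have c: "\<forall>w\<in>basis (reg j). star_output a b j t w = ghz_vec ?p ?q j w"
    using star_output_ghz[OF j] by (simp add: k_def)
  have nz: "?p \<noteq> 0 \<or> ?q \<noteq> 0" using sq_norm_nonzeroD[OF _ c] pos by (simp add: star_prob_def)
  let ?l = "min k (j - k)"
  let ?d = "(a * b) ^ ?l / complex_of_real (sqrt 2)"
  have m: "star_index j t = (if k \<le> j - k then j - k - k else k - (j - k))"
    using kj unfolding star_index_def k_def[symmetric] by auto
  have pq: "(?p = ?d * a ^ star_index j t \<and> ?q = ?d * b ^ star_index j t) \<or> (?p = ?d * b ^ star_index j t \<and> ?q = ?d * a ^ star_index j t)"
  proof (cases "k \<le> j - k")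
    case True
    then obtain e where e: "j - k = k + e" using le_Suc_ex by blast
    show ?thesis using True unfolding m e by (simp add: power_add power_mult_distrib)
  next
    case False
    then obtain e where e: "k = (j - k) + e" using le_Suc_ex nat_le_linear by blast
    define h where "h = j - k"
    have jk: "j - k = h" and e: "k = h + e" using e by (simp_all add: h_def)
    show ?thesis using False unfolding m jk unfolding e by (simp add: power_add power_mult_distrib)
  qed
  have "?d \<noteq> 0" using nz pq by auto
  then show ?thesis using same_state_ghz[OF ab _ pq c] j by simp
qed

theorem linear_output_same_state:
  assumes ab: "a \<noteq> 0 \<or> b \<noteq> 0" and r: "r \<in> {1..j}" "r' \<in> {1..j}" "r \<noteq> r'"
    and pos: "linear_prob a b j m (r, r') (s, t) \<noteq> 0"
  shows "same_state j (linear_output a b j m (r, r') (s, t)) (xi a b j (linear_index m (s, t)))"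
proof -
  let ?N = "complex_of_real (nrm a b m * sqrt 2)"
  let ?p = "a^m * (if t then b else a) / ?N" and ?q = "b^m * (if t then a else b) / ?N"
  let ?i = "linear_index m (s, t)"
  let ?d = "(if t \<and> m \<noteq> 0 then a * b else 1) / ?N"
  have c: "\<forall>w\<in>basis (reg j). linear_output a b j m (r, r') (s, t) w = ghz_vec ?p ?q j w"
    using linear_output_ghz[OF r] by blast
  have nz: "?p \<noteq> 0 \<or> ?q \<noteq> 0" using sq_norm_nonzeroD[OF _ c] pos by (simp add: linear_prob_def)
  have pq: "(?p = ?d * a ^ ?i \<and> ?q = ?d * b ^ ?i) \<or> (?p = ?d * b ^ ?i \<and> ?q = ?d * a ^ ?i)"
    by (cases m; cases t) (auto simp: linear_index_def nat_diff_distrib)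
  have "?d \<noteq> 0" using nz pq by auto
  then show ?thesis using same_state_ghz[OF ab _ pq c] r by simp
qed

end

theory Submission
  imports Defs
begin

text \<open>
  Write \<open>A = |a|\<^sup>2\<close>, \<open>B = |b|\<^sup>2\<close> and \<open>N m = A ^ m + B ^ m\<close>. A linear swap leads from index \<open>m > 0\<close> to
  \<open>m + 1\<close> with probability \<open>N (m + 1) / N m\<close> and to \<open>m - 1\<close> with probability
  \<open>A * B * N (m - 1) / N m\<close>, so after multiplying the probability of reaching index \<open>0\<close> by \<open>N m\<close>,
  every path from \<open>m\<close> to \<open>0\<close> gets the same weight, and it remains to count the paths of a simple
  random walk. A star outcome with \<open>k\<close> ones among \<open>t\<^sub>2, \<dots>, t\<^sub>j\<close> contributes in the same way one of
  the \<open>(j - 1) choose k\<close> walks of length \<open>j - 1\<close>, and Vandermonde's identity puts the two parts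
  together.
\<close>

section \<open>Outcome probabilities\<close>

lemma basis_eq_image_Pow: "basis S = (\<lambda>T q. q \<in> T) ` Pow S"
proof -
  have "w \<in> (\<lambda>T q. q \<in> T) ` Pow S" if "w \<in> basis S" for w
    using that by (intro image_eqI[of _ _ "{q. w q}"]) (auto simp: basis_def)
  then show ?thesis by (auto simp: basis_def)
qed

lemma finite_basis: "finite S \<Longrightarrow> finite (basis S)"
  by (simp add: basis_eq_image_Pow)

lemma finite_reg: "finite (reg j)"
  by (simp add: reg_def)

text \<open>As \<open>reg j\<close> is nonempty, the two kets are distinct basis vectors and their
  squared amplitudes simply add.\<close>

lemma sq_norm_ghz:
  assumes "1 \<le> j" and "\<forall>w\<in>basis (reg j). \<phi> w = ghz_vec p q j w"
  shows "sq_norm (reg j) \<phi> = (cmod p)\<^sup>2 + (cmod q)\<^sup>2"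
proof -
  have ne: "ones {} \<noteq> ones (reg j)"
    using assms(1) by (auto simp: ones_def fun_eq_iff reg_def)
  have "sq_norm (reg j) \<phi> = (\<Sum>w\<in>basis (reg j). (cmod (ghz_vec p q j w))\<^sup>2)"
    unfolding sq_norm_def using assms(2) by (intro sum.cong) auto
  also have "\<dots> = (\<Sum>w\<in>{ones {}, ones (reg j)}. (cmod (ghz_vec p q j w))\<^sup>2)"
  proof (rule sum.mono_neutral_right)
    show "finite (basis (reg j))" by (simp add: finite_basis finite_reg)
  qed (auto simp: basis_def ones_def ghz_vec_def ket_def)
  also have "\<dots> = (cmod p)\<^sup>2 + (cmod q)\<^sup>2"
    using ne by (simp add: ghz_vec_def ket_def)
  finally show ?thesis .
qed

lemma star_prob_eq:
  fixes a b :: complex and t :: "qubit bits"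
  assumes "2 \<le> j"
  defines "k \<equiv> card {i\<in>{2..j}. t (Central i)}"
  defines "A \<equiv> (cmod a)\<^sup>2" and "B \<equiv> (cmod b)\<^sup>2"
  shows "star_prob a b j t = (A ^ (j - k) * B ^ k + B ^ (j - k) * A ^ k) / 2"
proof -
  have "star_prob a b j t = (cmod (a ^ (j - k) * b ^ k / sqrt 2))\<^sup>2 + (cmod (b ^ (j - k) * a ^ k / sqrt 2))\<^sup>2"
    unfolding star_prob_def k_def using assms(1) star_output_ghz[OF assms(1)]
    by (intro sq_norm_ghz) auto
  then show ?thesis
    by (simp add: A_def B_def norm_mult norm_divide norm_power power_divide power_mult_distrib
        power_even_eq[symmetric] power_mult[symmetric] mult.commute add_divide_distrib)
qed

text \<open>The outcome \<open>s\<close> affects only a sign, undone by the \<open>Z\<close>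
  correction, so its two values are equally likely: hence the factor 2 in the denominator.\<close>

lemma linear_prob_eq:
  fixes a b :: complex
  assumes r: "r \<in> {1..j}" "r' \<in> {1..j}" "r \<noteq> r'"
  defines "A \<equiv> (cmod a)\<^sup>2" and "B \<equiv> (cmod b)\<^sup>2"
  shows "linear_prob a b j m (r, r') (s, t) =
    (if t then A ^ m * B + B ^ m * A else A ^ Suc m + B ^ Suc m) / (2 * (A ^ m + B ^ m))"
proof -
  let ?N = "nrm a b m * sqrt 2"
  let ?c = "if t then b else a" and ?d = "if t then a else b"
  have "(nrm a b m)\<^sup>2 = A ^ m + B ^ m"
    by (simp add: nrm_def A_def B_def power_mult)
  then have N: "?N\<^sup>2 = 2 * (A ^ m + B ^ m)"
    by (simp add: power_mult_distrib)
  have "linear_prob a b j m (r, r') (s, t) =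
      (cmod (a ^ m * ?c / complex_of_real ?N))\<^sup>2 + (cmod (b ^ m * ?d / complex_of_real ?N))\<^sup>2"
    unfolding linear_prob_def using r linear_output_ghz[OF r] by (intro sq_norm_ghz) auto
  also have "\<dots> = ((cmod (a ^ m * ?c))\<^sup>2 + (cmod (b ^ m * ?d))\<^sup>2) / ?N\<^sup>2"
    by (simp only: norm_divide norm_of_real power_divide power2_abs add_divide_distrib)
  also have "(cmod (a ^ m * ?c))\<^sup>2 + (cmod (b ^ m * ?d))\<^sup>2 =
      (if t then A ^ m * B + B ^ m * A else A ^ Suc m + B ^ Suc m)"
    by (simp add: A_def B_def norm_mult norm_power power_mult_distrib power_mult[symmetric] mult.commute)
  finally show ?thesis unfolding N .
qed


section \<open>The linear swaps as a random walk\<close>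

definition return_prob :: "complex \<Rightarrow> complex \<Rightarrow> nat \<Rightarrow> (nat \<times> nat) list \<Rightarrow> nat \<Rightarrow> real" where
  "return_prob a b j rs m =
     (\<Sum>os \<in> {os. length os = length rs \<and> chain_index m os = 0}. chain_prob a b j m rs os)"

text \<open>First-step decomposition: an outcome list splits into its head and a list that starts
  from the updated index.\<close>

lemma return_prob_Cons:
  "return_prob a b j (rr # rs) m =
     (\<Sum>st\<in>UNIV. linear_prob a b j m rr st * return_prob a b j rs (linear_index m st))"
proof -
  let ?S = "\<lambda>st. {os. length os = length rs \<and> chain_index (linear_index m st) os = 0}"
  have fin: "finite (?S st)" for st
    by (rule finite_subset[OF _ finite_lists_length_eq[of "UNIV :: (bool \<times> bool) set" "length rs"]]) auto
  have "return_prob a b j (rr # rs) m =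
      (\<Sum>(st, os) \<in> (SIGMA st:UNIV. ?S st). chain_prob a b j m (rr # rs) (st # os))"
    unfolding return_prob_def
    by (rule sum.reindex_bij_witness[where i = "\<lambda>(st, os). st # os" and j = "\<lambda>os. (hd os, tl os)"])
      (auto simp: length_Suc_conv)
  also have "\<dots> = (\<Sum>st\<in>UNIV. \<Sum>os\<in>?S st. chain_prob a b j m (rr # rs) (st # os))"
    using fin by (subst sum.Sigma) auto
  finally show ?thesis
    by (simp add: return_prob_def sum_distrib_left)
qed

text \<open>
  A walk of length \<open>l\<close> from \<open>m\<close> to \<open>0\<close> has \<open>(l + m) / 2\<close> down-steps, each of weight \<open>c = A * B\<close>. The
  reflection at \<open>0\<close> and \<open>N 0 = 2\<close> account for the factor \<open>2\<close>.
\<close>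

definition walk_weight :: "real \<Rightarrow> nat \<Rightarrow> nat \<Rightarrow> real" where
  "walk_weight c l m =
     (if even (l + m) then 2 * real (l choose ((l + m) div 2)) * c ^ ((l + m) div 2) else 0)"

text \<open>Pascal's rule, whose two summands coincide by symmetry.\<close>

lemma choose_middle_eq_double:
  "real ((2 * Suc n) choose Suc n) = 2 * real (Suc (2 * n) choose Suc n)"
proof -
  have "Suc (2 * n) choose n = Suc (2 * n) choose Suc n"
    by (subst binomial_symmetric) auto
  then show ?thesis by simp
qed

lemma walk_weight_0_right: "walk_weight c (Suc l) 0 = 2 * walk_weight c l 1"
proof (cases "even l")
  case False
  then obtain n where "l = Suc (2 * n)" by (auto elim: oddE)
  then show ?thesis
    using choose_middle_eq_double[of n] by (simp add: walk_weight_def)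
qed (simp add: walk_weight_def)

text \<open>Pascal's rule, read as a split by the first step: up with weight 1, down with weight
  \<open>c\<close>.\<close>

lemma walk_weight_Suc_right:
  "walk_weight c (Suc l) (Suc m) = walk_weight c l (Suc (Suc m)) + c * walk_weight c l m"
proof (cases "even (l + m)")
  case True
  then obtain n where "l + m = 2 * n" by (rule evenE)
  then show ?thesis by (simp add: walk_weight_def algebra_simps)
qed (simp add: walk_weight_def)

lemma return_prob_eq_walk_weight:
  fixes a b :: complex
  assumes ab: "(cmod a)\<^sup>2 + (cmod b)\<^sup>2 = 1"
    and rs: "\<forall>(r, r') \<in> set rs. r \<in> {1..j} \<and> r' \<in> {1..j} \<and> r \<noteq> r'"
  defines "A \<equiv> (cmod a)\<^sup>2" and "B \<equiv> (cmod b)\<^sup>2"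
  shows "(A ^ m + B ^ m) * return_prob a b j rs m = walk_weight (A * B) (length rs) m"
  using rs
proof (induction rs arbitrary: m)
  case Nil
  have *: "{os. os = [] \<and> chain_index m os = 0} = (if m = 0 then {[]} else {})"
    by auto
  \<comment> \<open>For even \<open>m > 0\<close> the binomial \<open>0 choose (m div 2)\<close>
    vanishes; for \<open>m = 0\<close> both sides are 2.\<close>
  show ?case
    by (auto simp: return_prob_def walk_weight_def * binomial_eq_0 elim: evenE)
next
  case (Cons rr rs)
  obtain r r' where rr: "rr = (r, r')" by (cases rr)
  from Cons.prems have r: "r \<in> {1..j}" "r' \<in> {1..j}" "r \<noteq> r'"
    and rs: "\<forall>(r, r') \<in> set rs. r \<in> {1..j} \<and> r' \<in> {1..j} \<and> r \<noteq> r'"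
    by (auto simp: rr)
  note IH = Cons.IH[OF rs]
  let ?N = "\<lambda>m. A ^ m + B ^ m"
  let ?R = "return_prob a b j rs"
  have N: "?N m > 0"
  proof -
    have "A > 0 \<or> B > 0" "A \<ge> 0" "B \<ge> 0"
      using ab by (auto simp: A_def B_def)
    then show ?thesis by (auto intro: add_pos_nonneg add_nonneg_pos)
  qed
  have p: "linear_prob a b j m rr (s, t) =
      (if t then A ^ m * B + B ^ m * A else ?N (Suc m)) / (2 * ?N m)" for s t
    unfolding rr A_def B_def by (rule linear_prob_eq[OF r])
  have U: "(UNIV :: (bool \<times> bool) set) = {(False, False), (False, True), (True, False), (True, True)}"
    by auto
  \<comment> \<open>The outcomes with \<open>s\<close> false and \<open>s\<close> true contribute
    equally, which cancels the 2 in the denominators.\<close>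
  have half: "X / (2 * D) * R + (Y / (2 * D) * R' + (X / (2 * D) * R + Y / (2 * D) * R')) =
      (X * R + Y * R') / D" if "D > 0" for X Y D R R' :: real
    using that by (simp add: field_simps)
  have "return_prob a b j (rr # rs) m =
      (?N (Suc m) * ?R (Suc m) + (A ^ m * B + B ^ m * A) * ?R (nat \<bar>int m - 1\<bar>)) / ?N m"
    unfolding return_prob_Cons U half[OF N, symmetric] by (simp add: p linear_index_def)
  then have step: "?N m * return_prob a b j (rr # rs) m =
      ?N (Suc m) * ?R (Suc m) + (A ^ m * B + B ^ m * A) * ?R (nat \<bar>int m - 1\<bar>)"
    using N by simp
  show ?case
  proof (cases m)
    case 0
    \<comment> \<open>Both values of \<open>t\<close> lead from 0 to 1, each with numerator
      \<open>A + B = 1\<close>; their sum is the doubling in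
      \<open>walk_weight_0_right\<close>.\<close>
    have "A + B = 1" using ab by (simp add: A_def B_def)
    then show ?thesis
      using IH[of 1] unfolding step by (simp add: 0 walk_weight_0_right add.commute)
  next
    case (Suc n)
    \<comment> \<open>Away from 0, \<open>A ^ m * B + B ^ m * A\<close> factors as
      \<open>A * B * ?N n\<close>, which supplies the weight needed at index
      \<open>n\<close>.\<close>
    have "?N m * return_prob a b j (rr # rs) m =
        ?N (Suc m) * ?R (Suc m) + A * B * (?N n * ?R n)"
      unfolding step by (simp add: Suc algebra_simps)
    then show ?thesis
      unfolding IH by (simp add: Suc walk_weight_Suc_right)
  qed
qed


section \<open>Counting the star outcomes\<close>

lemma sum_Pow_card:
  fixes f :: "nat \<Rightarrow> real"
  assumes "finite S"
  shows "(\<Sum>T\<in>Pow S. f (card T)) = (\<Sum>k\<le>card S. real (card S choose k) * f k)"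
proof -
  have "(\<Sum>T\<in>Pow S. f (card T)) = (\<Sum>k\<le>card S. \<Sum>T\<in>{T \<in> Pow S. card T = k}. f (card T))"
    by (rule sum.group[symmetric]) (use assms in \<open>auto intro: card_mono\<close>)
  also have "\<dots> = (\<Sum>k\<le>card S. real (card {T. T \<subseteq> S \<and> card T = k}) * f k)"
    by (intro sum.cong) (auto simp: Pow_def)
  finally show ?thesis using assms by (simp add: n_subsets)
qed

text \<open>The factor 2 is the free outcome of \<open>Central 1\<close>; the other outcomes form a
  subset of \<open>{2..j}\<close>.\<close>

lemma sum_star_outcomes:
  fixes f :: "nat \<Rightarrow> real"
  assumes "1 \<le> j"
  shows "(\<Sum>t\<in>basis (Central ` {1..j}). f (card {i\<in>{2..j}. t (Central i)})) =
    2 * (\<Sum>k\<le>j - 1. real ((j - 1) choose k) * f k)"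
proof -
  let ?w = "\<lambda>(s, T) q. case q of Central i \<Rightarrow> if i = 1 then s else i \<in> T | _ \<Rightarrow> False"
  have "(\<Sum>t\<in>basis (Central ` {1..j}). f (card {i\<in>{2..j}. t (Central i)})) =
      (\<Sum>(s, T)\<in>(UNIV :: bool set) \<times> Pow {2..j}. f (card T))"
  proof (rule sum.reindex_bij_witness[where i = ?w
        and j = "\<lambda>t. (t (Central 1), {i\<in>{2..j}. t (Central i)})"])
    fix t assume t: "t \<in> basis (Central ` {1..j})"
    then have out: "q \<in> Central ` {1..j}" if "t q" for q
      using that by (auto simp: basis_def)
    show "?w (t (Central 1), {i\<in>{2..j}. t (Central i)}) = t"
    proof
      fix q
      show "?w (t (Central 1), {i\<in>{2..j}. t (Central i)}) q = t q"
      proof (cases q)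
        case (Central i)
        have "t (Central i) \<longrightarrow> 1 \<le> i \<and> i \<le> j" using out[of "Central i"] by auto
        then show ?thesis using Central by (cases "i = 1") auto
      qed (use out in auto)
    qed
  next
    fix sT :: "bool \<times> nat set" assume "sT \<in> UNIV \<times> Pow {2..j}"
    then show "?w sT \<in> basis (Central ` {1..j})"
      using assms by (force simp: basis_def split: qubit.split)
  qed fastforce+
  also have "\<dots> = 2 * (\<Sum>T\<in>Pow {2..j}. f (card T))"
    by (simp add: sum.cartesian_product[symmetric] UNIV_bool)
  finally show ?thesis
    by (simp add: sum_Pow_card)
qed

text \<open>The star probability is half of \<open>A ^ m + B ^ m\<close> times
  \<open>c ^ min k (j - k)\<close>. The half cancels the 2 in \<open>walk_weight\<close>, and the
  exponents of \<open>c\<close> add up to \<open>n\<close> whatever \<open>k\<close> is.\<close>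

lemma star_then_walk:
  assumes k: "k < j" "j \<le> 2 * n" and c: "c = A * B"
    and w: "(A ^ m + B ^ m) * R = walk_weight c (2 * n - j) m"
    and m: "m = nat \<bar>int j - 2 * int k\<bar>"
  shows "(A ^ (j - k) * B ^ k + B ^ (j - k) * A ^ k) / 2 * R =
    (if k \<le> n then real ((2 * n - j) choose (n - k)) else 0) * c ^ n"
proof (cases "2 * k \<le> j")
  case True
  then have m': "m = j - 2 * k" and jk: "j - k = m + k" using m by auto
  have e: "2 * n - j + m = 2 * (n - k)" using True k m' by simp
  have "(A ^ (j - k) * B ^ k + B ^ (j - k) * A ^ k) / 2 * R = c ^ k / 2 * ((A ^ m + B ^ m) * R)"
    by (simp add: jk c power_add power_mult_distrib algebra_simps)
  also have "\<dots> = real ((2 * n - j) choose (n - k)) * (c ^ k * c ^ (n - k))"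
    unfolding w walk_weight_def e by simp
  also have "c ^ k * c ^ (n - k) = c ^ n"
    using True k by (simp flip: power_add)
  finally show ?thesis using True k by simp
next
  case False
  define h where "h = j - k"
  have m': "m = 2 * k - j" and kh: "k = m + h" and jk: "j - k = h"
    using m False k by (auto simp: h_def)
  have e: "2 * n - j + m = 2 * (n - h)" using False k m' by (auto simp: h_def)
  have hn: "h \<le> n" using False k by (simp add: h_def)
  have "(A ^ (j - k) * B ^ k + B ^ (j - k) * A ^ k) / 2 * R = c ^ h / 2 * ((A ^ m + B ^ m) * R)"
    unfolding jk unfolding kh by (simp add: c power_add power_mult_distrib algebra_simps)
  also have "\<dots> = real ((2 * n - j) choose (n - h)) * (c ^ h * c ^ (n - h))"
    unfolding w walk_weight_def e by simp
  also have "c ^ h * c ^ (n - h) = c ^ n"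
    using hn by (simp flip: power_add)
  \<comment> \<open>Binomial symmetry gives the same form as in the first case; for
    \<open>k > n\<close> the lower entry exceeds the upper one.\<close>
  also have "(2 * n - j) choose (n - h) = (if k \<le> n then (2 * n - j) choose (n - k) else 0)"
  proof (cases "k \<le> n")
    case True
    moreover have "j = h + k" using k by (simp add: h_def)
    ultimately have "2 * n - j = (n - h) + (n - k)" using hn by simp
    then show ?thesis using True binomial_symmetric[of "n - h" "2 * n - j"] by simp
  next
    case False
    then show ?thesis using k by (auto simp: h_def intro!: binomial_eq_0)
  qed
  finally show ?thesis by auto
qed

theorem mainTheorem8:
  fixes a b :: complex and x j :: nat and rs :: "(nat \<times> nat) list"
  assumes "(cmod a)\<^sup>2 + (cmod b)\<^sup>2 = 1"
    and "2 \<le> j" and "j \<le> x"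
    and "length rs = x - j"
    and "\<forall>(r, r') \<in> set rs. r \<in> {1..j} \<and> r' \<in> {1..j} \<and> r \<noteq> r'"
    and "even x"
  shows "P_max a b j rs = real (x choose (x div 2)) * cmod a ^ x * cmod b ^ x"
proof -
  define A B where "A = (cmod a)\<^sup>2" and "B = (cmod b)\<^sup>2"
  obtain n where x: "x = 2 * n" using \<open>even x\<close> by (auto elim: evenE)
  define K where "K t = card {i\<in>{2..j}. t (Central i)}" for t :: "qubit bits"
  \<comment> \<open>The guard is needed because truncated subtraction would turn the binomial into 1
    for \<open>k > n\<close>.\<close>
  define g where "g k = (if k \<le> n then real ((2 * n - j) choose (n - k)) else 0)" for k
  let ?T = "basis (Central ` {1..j})"
  let ?S = "\<lambda>t. {os. length os = length rs \<and> chain_index (star_index j t) os = 0}"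
  have fin: "finite (?S t)" for t
    by (rule finite_subset[OF _ finite_lists_length_eq[of "UNIV :: (bool \<times> bool) set" "length rs"]]) auto
  have "P_max a b j rs = (\<Sum>(t, os) \<in> (SIGMA t:?T. ?S t).
      star_prob a b j t * chain_prob a b j (star_index j t) rs os)"
    unfolding P_max_def final_prob_def by (intro sum.cong) auto
  also have "\<dots> = (\<Sum>t\<in>?T. star_prob a b j t * return_prob a b j rs (star_index j t))"
    by (subst sum.Sigma[symmetric]) (use fin in \<open>auto simp: finite_basis return_prob_def sum_distrib_left\<close>)
  also have "\<dots> = (\<Sum>t\<in>?T. g (K t) * (A * B) ^ n)"
  proof (intro sum.cong refl)
    fix t :: "qubit bits"
    have "K t \<le> card {2..j}" unfolding K_def by (rule card_mono) auto
    then have K: "K t < j" using \<open>2 \<le> j\<close> by simp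
    have W: "(A ^ star_index j t + B ^ star_index j t) * return_prob a b j rs (star_index j t) =
        walk_weight (A * B) (2 * n - j) (star_index j t)"
      using return_prob_eq_walk_weight[OF assms(1,5)] assms(4) by (simp add: x A_def B_def)
    show "star_prob a b j t * return_prob a b j rs (star_index j t) = g (K t) * (A * B) ^ n"
      unfolding star_prob_eq[OF \<open>2 \<le> j\<close>] g_def A_def[symmetric] B_def[symmetric] K_def[symmetric]
      by (rule star_then_walk[OF K _ refl W]) (use \<open>j \<le> x\<close> in \<open>auto simp: x star_index_def K_def\<close>)
  qed
  also have "\<dots> = 2 * (\<Sum>k\<le>j - 1. real ((j - 1) choose k) * g k) * (A * B) ^ n"
    using sum_star_outcomes[of j g] \<open>2 \<le> j\<close> by (simp add: K_def flip: sum_distrib_right)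
  \<comment> \<open>Terms beyond \<open>n\<close> vanish by the guard and those beyond
    \<open>j - 1\<close> by the first binomial, so the sum takes Vandermonde's form.\<close>
  also have "(\<Sum>k\<le>j - 1. real ((j - 1) choose k) * g k) =
      (\<Sum>k\<le>n. real ((j - 1) choose k) * real ((2 * n - j) choose (n - k)))"
    by (rule sum.mono_neutral_cong) (auto simp: g_def binomial_eq_0)
  also have "\<dots> = real ((j - 1 + (2 * n - j)) choose n)"
    by (simp add: vandermonde[symmetric])
  also have "j - 1 + (2 * n - j) = 2 * n - 1"
    using \<open>2 \<le> j\<close> \<open>j \<le> x\<close> by (simp add: x)
  \<comment> \<open>The factor 2 from \<open>Central 1\<close> completes the central binomial;
    \<open>n\<close> is positive since \<open>2 \<le> j\<close> and
    \<open>j \<le> x\<close>.\<close>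
  also have "2 * real ((2 * n - 1) choose n) = real (x choose (x div 2))"
    using choose_middle_eq_double[of "n - 1"] \<open>2 \<le> j\<close> \<open>j \<le> x\<close> by (cases n) (auto simp: x)
  also have "(A * B) ^ n = cmod a ^ x * cmod b ^ x"
    by (simp add: A_def B_def x power_mult power_mult_distrib)
  finally show ?thesis by simp
qed

end
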